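(* Let $\mathsf A_\diamondsuit,\mathsf B_\diamondsuit$ be objects of $\mathsf{Traj}_{\diamondsuit,[t_0,T]}$ (realized AI system histories of type $\diamondsuit$ over $[t_0,T]$), and write $a(t)=\mathsf A_\diamondsuit(t)$, $b(t)=\mathsf B_\diamondsuit(t)$ for $t\in[t_0,T]$. Then the following hold. (i) For all $t\le t'$ in $[t_0,T]$, the history morphism $\mathsf A_{t,t'}\in\mathrm{Hom}_{\mathsf{Sys}_\diamondsuit}(a(t),a(t'))$ implies $a(t)\equiv_\tau a(t')$. Hence every realized AI system history satisfies the weak diachronic identity criterion. (ii) For $t\le t'$ in $[t_0,T]$, the states $a(t)$ and $a(t')$ satisfy strong diachronic identity, $a(t)\cong_{\mathsf{Sys}_\diamondsuit}a(t')$, if and only if there exists a morphism in $\mathsf{Sys}_\diamondsuit$ from $a(t')$ to $a(t)$. Equivalently, the realized history $\mathsf A_\diamondsuit$ satisfies strong diachronic identity throughout $[t_0,T]$ if and only if the functor $\mathsf A_\diamondsuit$ factors through the inclusion of the maximal subgroupoid $\mathrm{Core}(\mathsf{Sys}_\diamondsuit)\hookrightarrow\mathsf{Sys}_\diamondsuit$. (iii) If, for some $t\in[t_0,T]$, there exists a time-synchronous comparison morphism $\eta_t\in\mathrm{Hom}_{\mathsf{Sys}_\diamondsuit}(a(t),b(t))$ (i.e. a morphism admitting a time-synchronous representative at $t$), then $a(t)\equiv_\tau b(t)$. Consequently, the existence of a morphism $\eta:\mathsf A_\diamondsuit\Rightarrow\mathsf B_\diamondsuit$ in $\mathsf{Traj}_{\diamondsuit,[t_0,T]}$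 implies weak synchronic identity, $a(t)\equiv_\tau b(t)$, at every $t\in[t_0,T]$. (iv) At time $t\in[t_0,T]$, the states $a(t)$ and $b(t)$ satisfy strong synchronic identity (that is, $a(t)\cong_{\mathsf{Sys}_\diamondsuit}b(t)$ is witnessed time-synchronously) if and only if there exist morphisms $\eta_t\in\mathrm{Hom}_{\mathsf{Sys}_\diamondsuit}(a(t),b(t))$ and $\rho_t\in\mathrm{Hom}_{\mathsf{Sys}_\diamondsuit}(b(t),a(t))$, each admitting a time-synchronous representative at $t$. In particular, $\mathsf A_\diamondsuit\cong\mathsf B_\diamondsuit$ in $\mathsf{Traj}_{\diamondsuit,[t_0,T]}$ if and only if strong synchronic identity holds at every $t\in[t_0,T]$.
   Context: **Type datum and states.** Fix a type datum $\diamondsuit=(F,P,L_P)$: $F$ is a label (the "techno-function"), $P=\{p_1,\dots,p_n\}$ a finite list of dimensions, $I_P=[0,1]^n$, and $L_P:I_P\to[K]=\{1,\dots,K\}$ a function. The state set is $S_\diamondsuit=\{(q,L_P(q))\mid q\in I_P\}\subseteq I_P\times[K]$, and for $x=(q,k)\in S_\diamondsuit$ put $\tau_\diamondsuit(x)=k=L_P(q)$. Fix a set $\mathcal U_\diamondsuit$ (primitive lifecycle transformations); each $r\in\mathcal U_\diamondsuit$ is associated with a relation $R_r\subseteq S_\diamondsuit\times S_\diamondsuit$. **Path categories.** $\mathsf{Path}_\diamondsuit$ is the free path category with object set $S_\diamondsuit$ generated by one labelled arrow $r_{x,y}:x\to y$ for every $r\in\mathcal U_\diamondsuit$ and $(x,y)\in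 R_r$. Its morphisms are finite paths $x=x_0\xrightarrow{r_1}x_1\to\cdots\xrightarrow{r_m}x_m=y$ with $(x_{i-1},x_i)\in R_{r_i}$; identities are empty paths; composition is concatenation. A path is trustworthiness-level-preserving if $\tau_\diamondsuit(x_0)=\tau_\diamondsuit(x_1)=\cdots=\tau_\diamondsuit(x_m)$. $\mathsf{Path}^\tau_\diamondsuit$ is the wide subcategory of $\mathsf{Path}_\diamondsuit$ with only the level-preserving paths as morphisms. **State category.** $\mathsf{Sys}_\diamondsuit=\mathsf{Path}^\tau_\diamondsuit/{\sim_\tau}$ is the quotient category obtained by identifying all parallel morphisms of $\mathsf{Path}^\tau_\diamondsuit$: objects are the elements of $S_\diamondsuit$, and a morphism $x\to y$ is an equivalence class of level-preserving paths from $x$ to $y$, with $f\sim_\tau g$ for all parallel $f,g$. A path in a class is said to represent that morphism. $\mathrm{Core}(\mathcal C)$ is the subcategory of $\mathcal C$ with all objects and only the isomorphisms. **Histories.** Fix reals $t_0\le T$. $\mathsf T_{[t_0,T]}$ is the poset category of $[t_0,T]$ with its usual order. For a functor $\mathsf A_\diamondsuit:\mathsf T_{[t_0,T]}\to\mathsf{Sys}_\diamondsuit$ and $t\le t'$, $\mathsf A_{t,t'}$ denotes the image of the unique arrow $t\to t'$. A path $\mathsf A_\diamondsuit(t)=x_0\xrightarrow{r_1}\cdots\xrightarrow{r_m}x_m=\mathsf A_\diamondsuit(t')$ in $\mathsf{Path}^\tau_\diamondsuit$ representing $\mathsf A_{t,t'}$ is an $\mathsf A_\diamondsuit$-time-ordered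 representative over $[t,t']$ if either (a) $m=0$ and $\mathsf A_\diamondsuit(s)=\mathsf A_\diamondsuit(t)$ for all $s\in[t,t']$, or (b) $m\ge1$ and there are times $t=s_0\le s_1\le\cdots\le s_m=t'$ with $x_i=\mathsf A_\diamondsuit(s_i)$ for all $i$. An AI system history over $[t_0,T]$ is a functor $\mathsf A_\diamondsuit:\mathsf T_{[t_0,T]}\to\mathsf{Sys}_\diamondsuit$ such that every $\mathsf A_{t,t'}$ ($t\le t'$) admits at least one $\mathsf A_\diamondsuit$-time-ordered representative over $[t,t']$. **Realized histories.** There is a given collection of deployed tokens $u$ existing throughout $[t_0,T]$; each has a profile $q_P^u:[t_0,T]\to I_P$ and induced state assignment $\sigma_u:[t_0,T]\to S_\diamondsuit$, $\sigma_u(t)=(q_P^u(t),L_P(q_P^u(t)))$. A history $\mathsf A_\diamondsuit$ over $[t_0,T]$ is realized if there is at least one token $u$ with $\sigma_u(t)=\mathsf A_\diamondsuit(t)$ for all $t\in[t_0,T]$. Let $\mathcal H^{\mathrm{real}}_{\diamondsuit,[t_0,T]}$ be the collection of realized histories and $S^{\mathrm{real}}_\diamondsuit(t)=\{\mathsf C_\diamondsuit(t)\mid\mathsf C_\diamondsuit\in\mathcal H^{\mathrm{real}}_{\diamondsuit,[t_0,T]}\}$. **Time-synchronous representatives and $\mathsf{Traj}$.** For realized histories $\mathsf A_\diamondsuit,\mathsf B_\diamondsuit$ and $h\in\mathrm{Hom}_{\mathsf{Sys}_\diamondsuit}(\mathsf A_\diamondsuit(t),\mathsf B_\diamondsuit(t))$,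 a path $x_0\to\cdots\to x_m$ in $\mathsf{Path}^\tau_\diamondsuit$ representing $h$ is time-synchronous at $t$ if $x_i\in S^{\mathrm{real}}_\diamondsuit(t)$ for all $i$. $\mathsf{Traj}_{\diamondsuit,[t_0,T]}$ is the category whose objects are the realized histories and whose morphisms $\mathsf A_\diamondsuit\to\mathsf B_\diamondsuit$ are the natural transformations $\eta:\mathsf A_\diamondsuit\Rightarrow\mathsf B_\diamondsuit$ (in the functor category $[\mathsf T_{[t_0,T]},\mathsf{Sys}_\diamondsuit]$) such that every component $\eta_t$ admits at least one time-synchronous representative at $t$. **Identity relations.** For $x,y\in S_\diamondsuit$: weak identity $x\equiv_\tau y$ means $\tau_\diamondsuit(x)=\tau_\diamondsuit(y)$; strong identity $x\cong_{\mathsf{Sys}_\diamondsuit}y$ means $x$ and $y$ are isomorphic in $\mathsf{Sys}_\diamondsuit$. Diachronic identity compares $a(t)$ and $a(t')$ along the same history (weak: $a(t)\equiv_\tau a(t')$; strong: $a(t)\cong_{\mathsf{Sys}_\diamondsuit}a(t')$; "throughout $[t_0,T]$" means for all $t\le t'$ in $[t_0,T]$). Synchronic identity compares $a(t)$ and $b(t)$ at the same time (weak: $a(t)\equiv_\tau b(t)$; strong: $a(t)\cong_{\mathsf{Sys}_\diamondsuit}b(t)$ is witnessed time-synchronously, i.e. there is an isomorphism $a(t)\to b(t)$ in $\mathsf{Sys}_\diamondsuit$ such that it and its inverse each admit a time-synchronous representative at $t$). *)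

theory Defs
  imports Complex_Main "HOL-Library.FuncSet"
begin

section \<open>Categories, functors and natural transformations\<close>

text \<open>
  A small category is given by carriers of objects and arrows; \<open>Cmp C g f\<close> is the composite
  ``g after f''. Nothing is required of the operations outside the carriers.
\<close>

record ('o, 'm) cat =
  Obj :: "'o set"
  Arr :: "'m set"
  Dom :: "'m \<Rightarrow> 'o"
  Cod :: "'m \<Rightarrow> 'o"
  Ident :: "'o \<Rightarrow> 'm"
  Cmp :: "'m \<Rightarrow> 'm \<Rightarrow> 'm"

definition hom :: "('o, 'm) cat \<Rightarrow> 'o \<Rightarrow> 'o \<Rightarrow> 'm set" where
  "hom C x y = {f \<in> Arr C. Dom C f = x \<and> Cod C f = y}"

locale category =
  fixes C :: "('o, 'm) cat"
  assumes Dom_Obj: "f \<in> Arr C \<Longrightarrow> Dom C f \<in> Obj C"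
    and Cod_Obj: "f \<in> Arr C \<Longrightarrow> Cod C f \<in> Obj C"
    and Ident_hom: "x \<in> Obj C \<Longrightarrow> Ident C x \<in> hom C x x"
    and Cmp_hom: "\<lbrakk>f \<in> hom C x y; g \<in> hom C y z\<rbrakk> \<Longrightarrow> Cmp C g f \<in> hom C x z"
    and Cmp_Ident_right: "f \<in> hom C x y \<Longrightarrow> Cmp C f (Ident C x) = f"
    and Cmp_Ident_left: "f \<in> hom C x y \<Longrightarrow> Cmp C (Ident C y) f = f"
    and Cmp_assoc: "\<lbrakk>f \<in> hom C w x; g \<in> hom C x y; h \<in> hom C y z\<rbrakk>
        \<Longrightarrow> Cmp C h (Cmp C g f) = Cmp C (Cmp C h g) f"

definition inverse_arrows :: "('o, 'm) cat \<Rightarrow> 'm \<Rightarrow> 'm \<Rightarrow> bool" where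
  "inverse_arrows C f g \<longleftrightarrow>
     f \<in> Arr C \<and> g \<in> hom C (Cod C f) (Dom C f) \<and>
     Cmp C g f = Ident C (Dom C f) \<and> Cmp C f g = Ident C (Cod C f)"

definition iso :: "('o, 'm) cat \<Rightarrow> 'm \<Rightarrow> bool" where
  "iso C f \<longleftrightarrow> (\<exists>g. inverse_arrows C f g)"

definition isomorphic :: "('o, 'm) cat \<Rightarrow> 'o \<Rightarrow> 'o \<Rightarrow> bool" where
  "isomorphic C x y \<longleftrightarrow> (\<exists>f \<in> hom C x y. iso C f)"

definition Core :: "('o, 'm) cat \<Rightarrow> ('o, 'm) cat" where
  "Core C = C\<lparr>Arr := {f \<in> Arr C. iso C f}\<rparr>"

definition parallel :: "('o, 'm) cat \<Rightarrow> ('m \<times> 'm) set" where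
  "parallel C = {(f, g). f \<in> Arr C \<and> g \<in> Arr C \<and> Dom C f = Dom C g \<and> Cod C f = Cod C g}"

text \<open>
  Quotient by an equivalence relation on arrows that relates parallel arrows only and is compatible
  with composition; under these conditions the values below do not depend on representatives.
\<close>

definition quotient_cat :: "('o, 'm) cat \<Rightarrow> ('m \<times> 'm) set \<Rightarrow> ('o, 'm set) cat" where
  "quotient_cat C E = \<lparr>
     Obj = Obj C,
     Arr = Arr C // E,
     Dom = (\<lambda>X. the_elem (Dom C ` X)),
     Cod = (\<lambda>X. the_elem (Cod C ` X)),
     Ident = (\<lambda>x. E `` {Ident C x}),
     Cmp = (\<lambda>Y X. \<Union>g\<in>Y. \<Union>f\<in>X. E `` {Cmp C g f})\<rparr>"

record ('o, 'm, 'p, 'n) functr =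
  fobj :: "'o \<Rightarrow> 'p"
  farr :: "'m \<Rightarrow> 'n"

text \<open>
  Functors and natural transformations are extensional outside the source category, so that
  logical equality is the equality of functors, respectively of natural transformations.
\<close>

definition is_functor :: "('o, 'm) cat \<Rightarrow> ('p, 'n) cat \<Rightarrow> ('o, 'm, 'p, 'n) functr \<Rightarrow> bool" where
  "is_functor C D F \<longleftrightarrow>
     fobj F \<in> Obj C \<rightarrow>\<^sub>E Obj D \<and>
     farr F \<in> Arr C \<rightarrow>\<^sub>E Arr D \<and>
     (\<forall>f \<in> Arr C. farr F f \<in> hom D (fobj F (Dom C f)) (fobj F (Cod C f))) \<and>
     (\<forall>x \<in> Obj C. farr F (Ident C x) = Ident D (fobj F x)) \<and>
     (\<forall>f \<in> Arr C. \<forall>g \<in> Arr C. Cod C f = Dom C g \<longrightarrow>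
        farr F (Cmp C g f) = Cmp D (farr F g) (farr F f))"

definition functor_comp ::
    "('o, 'm) cat \<Rightarrow> ('p, 'n, 'q, 'l) functr \<Rightarrow> ('o, 'm, 'p, 'n) functr \<Rightarrow> ('o, 'm, 'q, 'l) functr" where
  "functor_comp C G F = \<lparr>
     fobj = (\<lambda>x\<in>Obj C. fobj G (fobj F x)),
     farr = (\<lambda>f\<in>Arr C. farr G (farr F f))\<rparr>"

definition inclusion :: "('o, 'm) cat \<Rightarrow> ('o, 'm, 'o, 'm) functr" where
  "inclusion C = \<lparr>fobj = (\<lambda>x\<in>Obj C. x), farr = (\<lambda>f\<in>Arr C. f)\<rparr>"

definition factors_through_inclusion ::
    "('o, 'm) cat \<Rightarrow> ('p, 'n) cat \<Rightarrow> ('o, 'm, 'p, 'n) functr \<Rightarrow> bool" where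
  "factors_through_inclusion C D' F \<longleftrightarrow>
     (\<exists>G. is_functor C D' G \<and> F = functor_comp C (inclusion D') G)"

record ('o, 'm, 'p, 'n) nattrans =
  nsrc :: "('o, 'm, 'p, 'n) functr"
  ntgt :: "('o, 'm, 'p, 'n) functr"
  ncomp :: "'o \<Rightarrow> 'n"

definition is_nattrans :: "('o, 'm) cat \<Rightarrow> ('p, 'n) cat \<Rightarrow> ('o, 'm, 'p, 'n) nattrans \<Rightarrow> bool" where
  "is_nattrans C D \<eta> \<longleftrightarrow>
     is_functor C D (nsrc \<eta>) \<and> is_functor C D (ntgt \<eta>) \<and>
     ncomp \<eta> \<in> extensional (Obj C) \<and>
     (\<forall>x \<in> Obj C. ncomp \<eta> x \<in> hom D (fobj (nsrc \<eta>) x) (fobj (ntgt \<eta>) x)) \<and>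
     (\<forall>f \<in> Arr C. Cmp D (ncomp \<eta> (Cod C f)) (farr (nsrc \<eta>) f) =
                   Cmp D (farr (ntgt \<eta>) f) (ncomp \<eta> (Dom C f)))"

definition functor_cat ::
    "('o, 'm) cat \<Rightarrow> ('p, 'n) cat \<Rightarrow> (('o, 'm, 'p, 'n) functr, ('o, 'm, 'p, 'n) nattrans) cat" where
  "functor_cat C D = \<lparr>
     Obj = {F. is_functor C D F},
     Arr = {\<eta>. is_nattrans C D \<eta>},
     Dom = nsrc,
     Cod = ntgt,
     Ident = (\<lambda>F. \<lparr>nsrc = F, ntgt = F, ncomp = (\<lambda>x\<in>Obj C. Ident D (fobj F x))\<rparr>),
     Cmp = (\<lambda>\<theta> \<eta>. \<lparr>nsrc = nsrc \<eta>, ntgt = ntgt \<theta>,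
                     ncomp = (\<lambda>x\<in>Obj C. Cmp D (ncomp \<theta> x) (ncomp \<eta> x))\<rparr>)\<rparr>"

definition interval_cat :: "real \<Rightarrow> real \<Rightarrow> (real, real \<times> real) cat" where
  "interval_cat t\<^sub>0 T = \<lparr>
     Obj = {t\<^sub>0..T},
     Arr = {(t, t'). t \<in> {t\<^sub>0..T} \<and> t' \<in> {t\<^sub>0..T} \<and> t \<le> t'},
     Dom = fst,
     Cod = snd,
     Ident = (\<lambda>t. (t, t)),
     Cmp = (\<lambda>g f. (fst f, snd g))\<rparr>"


section \<open>Type data and states\<close>

text \<open>A point of \<open>[0,1]^n\<close> is the list of its coordinates, in the order of the list of dimensions.\<close>

record ('f, 'd) type_datum =
  techno_function :: 'f
  dimensions :: "'d list"
  level_map :: "real list \<Rightarrow> nat"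

type_synonym state = "real list \<times> nat"

definition profiles :: "('f, 'd) type_datum \<Rightarrow> real list set" where
  "profiles D = {q. length q = length (dimensions D) \<and> set q \<subseteq> {0..1}}"

definition states :: "('f, 'd) type_datum \<Rightarrow> state set" where
  "states D = {(q, level_map D q) | q. q \<in> profiles D}"

definition tau :: "state \<Rightarrow> nat" where
  "tau x = snd x"


section \<open>Path categories and the state category\<close>

text \<open>
  The pair \<open>(x\<^sub>0, [(r\<^sub>1, x\<^sub>1), \<dots>, (r\<^sub>m, x\<^sub>m)])\<close> stands for the path
  \<open>x\<^sub>0 \<rightarrow> x\<^sub>1 \<rightarrow> \<dots> \<rightarrow> x\<^sub>m\<close> whose \<open>i\<close>-th arrow carries the label \<open>r\<^sub>i\<close>.
\<close>

type_synonym 'r spath = "state \<times> ('r \<times> state) list"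

definition vertices :: "'r spath \<Rightarrow> state list" where
  "vertices p = fst p # map snd (snd p)"

definition path_length :: "'r spath \<Rightarrow> nat" where
  "path_length p = length (snd p)"

definition is_spath ::
    "('f, 'd) type_datum \<Rightarrow> 'r set \<Rightarrow> ('r \<Rightarrow> (state \<times> state) set) \<Rightarrow> 'r spath \<Rightarrow> bool" where
  "is_spath D U R p \<longleftrightarrow>
     fst p \<in> states D \<and>
     (\<forall>i < path_length p. fst (snd p ! i) \<in> U \<and>
        (vertices p ! i, vertices p ! Suc i) \<in> R (fst (snd p ! i)))"

definition Path ::
    "('f, 'd) type_datum \<Rightarrow> 'r set \<Rightarrow> ('r \<Rightarrow> (state \<times> state) set) \<Rightarrow> (state, 'r spath) cat" where
  "Path D U R = \<lparr>
     Obj = states D,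
     Arr = {p. is_spath D U R p},
     Dom = fst,
     Cod = (\<lambda>p. last (vertices p)),
     Ident = (\<lambda>x. (x, [])),
     Cmp = (\<lambda>q p. (fst p, snd p @ snd q))\<rparr>"

definition level_preserving :: "'r spath \<Rightarrow> bool" where
  "level_preserving p \<longleftrightarrow> (\<forall>x \<in> set (vertices p). tau x = tau (fst p))"

definition Path_tau ::
    "('f, 'd) type_datum \<Rightarrow> 'r set \<Rightarrow> ('r \<Rightarrow> (state \<times> state) set) \<Rightarrow> (state, 'r spath) cat" where
  "Path_tau D U R = (Path D U R)\<lparr>Arr := {p \<in> Arr (Path D U R). level_preserving p}\<rparr>"

definition Sys ::
    "('f, 'd) type_datum \<Rightarrow> 'r set \<Rightarrow> ('r \<Rightarrow> (state \<times> state) set) \<Rightarrow> (state, 'r spath set) cat" where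
  "Sys D U R = quotient_cat (Path_tau D U R) (parallel (Path_tau D U R))"

definition represents ::
    "('f, 'd) type_datum \<Rightarrow> 'r set \<Rightarrow> ('r \<Rightarrow> (state \<times> state) set) \<Rightarrow> 'r spath \<Rightarrow> 'r spath set \<Rightarrow> bool" where
  "represents D U R p h \<longleftrightarrow> p \<in> Arr (Path_tau D U R) \<and> h \<in> Arr (Sys D U R) \<and> p \<in> h"


section \<open>Histories\<close>

type_synonym 'r sys_functor = "(real, real \<times> real, state, 'r spath set) functr"

definition time_ordered_rep ::
    "('f, 'd) type_datum \<Rightarrow> 'r set \<Rightarrow> ('r \<Rightarrow> (state \<times> state) set) \<Rightarrow> 'r sys_functor \<Rightarrow>
     real \<Rightarrow> real \<Rightarrow> 'r spath \<Rightarrow> bool" where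
  "time_ordered_rep D U R A t t' p \<longleftrightarrow>
     represents D U R p (farr A (t, t')) \<and>
     (path_length p = 0 \<and> (\<forall>s \<in> {t..t'}. fobj A s = fobj A t) \<or>
      path_length p \<ge> 1 \<and>
      (\<exists>s :: nat \<Rightarrow> real. s 0 = t \<and> s (path_length p) = t' \<and>
         (\<forall>i < path_length p. s i \<le> s (Suc i)) \<and>
         (\<forall>i \<le> path_length p. vertices p ! i = fobj A (s i))))"

definition is_history ::
    "('f, 'd) type_datum \<Rightarrow> 'r set \<Rightarrow> ('r \<Rightarrow> (state \<times> state) set) \<Rightarrow> real \<Rightarrow> real \<Rightarrow>
     'r sys_functor \<Rightarrow> bool" where
  "is_history D U R t\<^sub>0 T A \<longleftrightarrow>
     is_functor (interval_cat t\<^sub>0 T) (Sys D U R) A \<and>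
     (\<forall>t \<in> {t\<^sub>0..T}. \<forall>t' \<in> {t\<^sub>0..T}. t \<le> t' \<longrightarrow> (\<exists>p. time_ordered_rep D U R A t t' p))"

text \<open>\<open>Tok\<close> is the collection of deployed tokens, and \<open>prof u\<close> is the profile of the token \<open>u\<close>.\<close>

definition token_state :: "('f, 'd) type_datum \<Rightarrow> ('u \<Rightarrow> real \<Rightarrow> real list) \<Rightarrow> 'u \<Rightarrow> real \<Rightarrow> state" where
  "token_state D prof u t = (prof u t, level_map D (prof u t))"

definition realized_histories ::
    "('f, 'd) type_datum \<Rightarrow> 'r set \<Rightarrow> ('r \<Rightarrow> (state \<times> state) set) \<Rightarrow> real \<Rightarrow> real \<Rightarrow>
     'u set \<Rightarrow> ('u \<Rightarrow> real \<Rightarrow> real list) \<Rightarrow> 'r sys_functor set" where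
  "realized_histories D U R t\<^sub>0 T Tok prof =
     {A. is_history D U R t\<^sub>0 T A \<and>
         (\<exists>u \<in> Tok. \<forall>t \<in> {t\<^sub>0..T}. token_state D prof u t = fobj A t)}"

definition realized_states ::
    "('f, 'd) type_datum \<Rightarrow> 'r set \<Rightarrow> ('r \<Rightarrow> (state \<times> state) set) \<Rightarrow> real \<Rightarrow> real \<Rightarrow>
     'u set \<Rightarrow> ('u \<Rightarrow> real \<Rightarrow> real list) \<Rightarrow> real \<Rightarrow> state set" where
  "realized_states D U R t\<^sub>0 T Tok prof t =
     {fobj H t | H. H \<in> realized_histories D U R t\<^sub>0 T Tok prof}"

definition time_synchronous_rep ::
    "('f, 'd) type_datum \<Rightarrow> 'r set \<Rightarrow> ('r \<Rightarrow> (state \<times> state) set) \<Rightarrow> real \<Rightarrow> real \<Rightarrow>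
     'u set \<Rightarrow> ('u \<Rightarrow> real \<Rightarrow> real list) \<Rightarrow> real \<Rightarrow> 'r spath set \<Rightarrow> 'r spath \<Rightarrow> bool" where
  "time_synchronous_rep D U R t\<^sub>0 T Tok prof t h p \<longleftrightarrow>
     represents D U R p h \<and> set (vertices p) \<subseteq> realized_states D U R t\<^sub>0 T Tok prof t"

definition Traj ::
    "('f, 'd) type_datum \<Rightarrow> 'r set \<Rightarrow> ('r \<Rightarrow> (state \<times> state) set) \<Rightarrow> real \<Rightarrow> real \<Rightarrow>
     'u set \<Rightarrow> ('u \<Rightarrow> real \<Rightarrow> real list) \<Rightarrow>
     ('r sys_functor, (real, real \<times> real, state, 'r spath set) nattrans) cat" where
  "Traj D U R t\<^sub>0 T Tok prof = (functor_cat (interval_cat t\<^sub>0 T) (Sys D U R))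
     \<lparr>Obj := realized_histories D U R t\<^sub>0 T Tok prof,
      Arr := {\<eta>. is_nattrans (interval_cat t\<^sub>0 T) (Sys D U R) \<eta> \<and>
                 nsrc \<eta> \<in> realized_histories D U R t\<^sub>0 T Tok prof \<and>
                 ntgt \<eta> \<in> realized_histories D U R t\<^sub>0 T Tok prof \<and>
                 (\<forall>t \<in> {t\<^sub>0..T}. \<exists>p. time_synchronous_rep D U R t\<^sub>0 T Tok prof t (ncomp \<eta> t) p)}\<rparr>"


section \<open>Identity relations\<close>

definition weak_identity :: "state \<Rightarrow> state \<Rightarrow> bool" where
  "weak_identity x y \<longleftrightarrow> tau x = tau y"

definition strong_identity ::
    "('f, 'd) type_datum \<Rightarrow> 'r set \<Rightarrow> ('r \<Rightarrow> (state \<times> state) set) \<Rightarrow> state \<Rightarrow> state \<Rightarrow> bool" where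
  "strong_identity D U R x y \<longleftrightarrow> isomorphic (Sys D U R) x y"

definition weak_diachronic_identity_throughout :: "real \<Rightarrow> real \<Rightarrow> 'r sys_functor \<Rightarrow> bool" where
  "weak_diachronic_identity_throughout t\<^sub>0 T A \<longleftrightarrow>
     (\<forall>t \<in> {t\<^sub>0..T}. \<forall>t' \<in> {t\<^sub>0..T}. t \<le> t' \<longrightarrow> weak_identity (fobj A t) (fobj A t'))"

definition strong_diachronic_identity_throughout ::
    "('f, 'd) type_datum \<Rightarrow> 'r set \<Rightarrow> ('r \<Rightarrow> (state \<times> state) set) \<Rightarrow> real \<Rightarrow> real \<Rightarrow>
     'r sys_functor \<Rightarrow> bool" where
  "strong_diachronic_identity_throughout D U R t\<^sub>0 T A \<longleftrightarrow>
     (\<forall>t \<in> {t\<^sub>0..T}. \<forall>t' \<in> {t\<^sub>0..T}. t \<le> t' \<longrightarrow> strong_identity D U R (fobj A t) (fobj A t'))"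

definition strong_synchronic_identity ::
    "('f, 'd) type_datum \<Rightarrow> 'r set \<Rightarrow> ('r \<Rightarrow> (state \<times> state) set) \<Rightarrow> real \<Rightarrow> real \<Rightarrow>
     'u set \<Rightarrow> ('u \<Rightarrow> real \<Rightarrow> real list) \<Rightarrow> 'r sys_functor \<Rightarrow> 'r sys_functor \<Rightarrow> real \<Rightarrow> bool" where
  "strong_synchronic_identity D U R t\<^sub>0 T Tok prof A B t \<longleftrightarrow>
     (\<exists>f g. f \<in> hom (Sys D U R) (fobj A t) (fobj B t) \<and> inverse_arrows (Sys D U R) f g \<and>
        (\<exists>p. time_synchronous_rep D U R t\<^sub>0 T Tok prof t f p) \<and>
        (\<exists>p. time_synchronous_rep D U R t\<^sub>0 T Tok prof t g p))"


section \<open>Standing assumptions\<close>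

locale lifecycle_setting =
  fixes K :: nat
    and D :: "('f, 'd) type_datum"
    and U :: "'r set"
    and R :: "'r \<Rightarrow> (state \<times> state) set"
    and t\<^sub>0 T :: real
    and Tok :: "'u set"
    and prof :: "'u \<Rightarrow> real \<Rightarrow> real list"
  assumes level_map: "level_map D \<in> profiles D \<rightarrow> {1..K}"
    and R_states: "r \<in> U \<Longrightarrow> R r \<subseteq> states D \<times> states D"
    and t0_le_T: "t\<^sub>0 \<le> T"
    and prof_profiles: "\<lbrakk>u \<in> Tok; t \<in> {t\<^sub>0..T}\<rbrakk> \<Longrightarrow> prof u t \<in> profiles D"


section \<open>The structures above are categories\<close>

lemma category_interval_cat: "category (interval_cat t\<^sub>0 T)"
  by unfold_locales (auto simp: interval_cat_def hom_def)

lemma category_functor_cat: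
  assumes "category C" "category D"
  shows "category (functor_cat C D)"
proof -
  interpret C: category C by fact
  interpret D: category D by fact
  have CC: "f \<in> hom C (Dom C f) (Cod C f)" if "f \<in> Arr C" for f
    using that by (simp add: hom_def)
  have homI: "farr F f \<in> hom D (fobj F (Dom C f)) (fobj F (Cod C f))"
    if "is_functor C D F" "f \<in> Arr C" for F f
    using that by (simp add: is_functor_def)
  have obj: "fobj F x \<in> Obj D" if "is_functor C D F" "x \<in> Obj C" for F x
    using that by (auto simp: is_functor_def)
  have ncomp: "ncomp \<eta> x \<in> hom D (fobj (nsrc \<eta>) x) (fobj (ntgt \<eta>) x)"
    if "is_nattrans C D \<eta>" "x \<in> Obj C" for \<eta> x
    using that by (simp add: is_nattrans_def)
  have nat: "Cmp D (ncomp \<eta> (Cod C f)) (farr (nsrc \<eta>) f) =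
             Cmp D (farr (ntgt \<eta>) f) (ncomp \<eta> (Dom C f))"
    if "is_nattrans C D \<eta>" "f \<in> Arr C" for \<eta> f
    using that by (simp add: is_nattrans_def)
  have homF: "\<eta> \<in> hom (functor_cat C D) F G \<longleftrightarrow> is_nattrans C D \<eta> \<and> nsrc \<eta> = F \<and> ntgt \<eta> = G"
    for \<eta> F G
    by (simp add: hom_def functor_cat_def)
  show ?thesis
  proof
    fix f assume "f \<in> Arr (functor_cat C D)"
    then show "Dom (functor_cat C D) f \<in> Obj (functor_cat C D)"
      and "Cod (functor_cat C D) f \<in> Obj (functor_cat C D)"
      by (auto simp: functor_cat_def is_nattrans_def)
  next
    fix F assume "F \<in> Obj (functor_cat C D)"
    then have F: "is_functor C D F" by (simp add: functor_cat_def)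
    then show "Ident (functor_cat C D) F \<in> hom (functor_cat C D) F F"
      unfolding homF
      by (auto simp: functor_cat_def is_nattrans_def C.Dom_Obj C.Cod_Obj D.Cmp_Ident_left[OF homI] D.Cmp_Ident_right[OF homI] D.Ident_hom obj)
  next
    fix \<eta> \<theta> F G H
    assume "\<eta> \<in> hom (functor_cat C D) F G" "\<theta> \<in> hom (functor_cat C D) G H"
    then have e: "is_nattrans C D \<eta>" "nsrc \<eta> = F" "ntgt \<eta> = G"
      and t: "is_nattrans C D \<theta>" "nsrc \<theta> = G" "ntgt \<theta> = H"
      by (auto simp: hom_def functor_cat_def)
    have fs: "is_functor C D F" "is_functor C D G" "is_functor C D H"
      using e t by (auto simp: is_nattrans_def)
    have cmp: "Cmp D (ncomp \<theta> x) (ncomp \<eta> x) \<in> hom D (fobj F x) (fobj H x)" if "x \<in> Obj C" for x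
      using D.Cmp_hom ncomp[OF e(1) that] ncomp[OF t(1) that] e t by metis
    have "Cmp D (Cmp D (ncomp \<theta> (Cod C f)) (ncomp \<eta> (Cod C f))) (farr F f) =
          Cmp D (farr H f) (Cmp D (ncomp \<theta> (Dom C f)) (ncomp \<eta> (Dom C f)))"
      if f: "f \<in> Arr C" for f
    proof -
      note d = C.Dom_Obj[OF f] and c = C.Cod_Obj[OF f]
      note hs = homI[OF fs(1) f] homI[OF fs(2) f] homI[OF fs(3) f]
        ncomp[OF e(1) d, unfolded e] ncomp[OF e(1) c, unfolded e]
        ncomp[OF t(1) d, unfolded t] ncomp[OF t(1) c, unfolded t]
      have "Cmp D (Cmp D (ncomp \<theta> (Cod C f)) (ncomp \<eta> (Cod C f))) (farr F f)
          = Cmp D (ncomp \<theta> (Cod C f)) (Cmp D (ncomp \<eta> (Cod C f)) (farr F f))"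
        using D.Cmp_assoc[OF hs(1) hs(5) hs(7)] by simp
      also have "\<dots> = Cmp D (ncomp \<theta> (Cod C f)) (Cmp D (farr G f) (ncomp \<eta> (Dom C f)))"
        using nat[OF e(1) f] e by simp
      also have "\<dots> = Cmp D (Cmp D (ncomp \<theta> (Cod C f)) (farr G f)) (ncomp \<eta> (Dom C f))"
        using D.Cmp_assoc[OF hs(4) hs(2) hs(7)] by simp
      also have "\<dots> = Cmp D (Cmp D (farr H f) (ncomp \<theta> (Dom C f))) (ncomp \<eta> (Dom C f))"
        using nat[OF t(1) f] t by simp
      also have "\<dots> = Cmp D (farr H f) (Cmp D (ncomp \<theta> (Dom C f)) (ncomp \<eta> (Dom C f)))"
        using D.Cmp_assoc[OF hs(4) hs(6) hs(3)] by simp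
      finally show ?thesis .
    qed
    then show "Cmp (functor_cat C D) \<theta> \<eta> \<in> hom (functor_cat C D) F H"
      using e t fs cmp C.Dom_Obj C.Cod_Obj unfolding homF
      by (simp add: functor_cat_def is_nattrans_def)
  next
    fix \<eta> F G assume "\<eta> \<in> hom (functor_cat C D) F G"
    then have e: "is_nattrans C D \<eta>" "nsrc \<eta> = F" "ntgt \<eta> = G"
      by (auto simp: hom_def functor_cat_def)
    have ext: "ncomp \<eta> \<in> extensional (Obj C)" using e by (simp add: is_nattrans_def)
    have "(\<lambda>x\<in>Obj C. Cmp D (ncomp \<eta> x) (Ident D (fobj F x))) = ncomp \<eta>"
      "(\<lambda>x\<in>Obj C. Cmp D (Ident D (fobj G x)) (ncomp \<eta> x)) = ncomp \<eta>"
      using D.Cmp_Ident_right[OF ncomp[OF e(1)]] D.Cmp_Ident_left[OF ncomp[OF e(1)]] e ext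
      by (auto intro!: extensionalityI[where A = "Obj C"])
    then show "Cmp (functor_cat C D) \<eta> (Ident (functor_cat C D) F) = \<eta>"
      and "Cmp (functor_cat C D) (Ident (functor_cat C D) G) \<eta> = \<eta>"
      using e by (simp_all add: functor_cat_def cong: restrict_cong)
  next
    fix \<eta> \<theta> \<zeta> F G H J
    assume "\<eta> \<in> hom (functor_cat C D) F G" "\<theta> \<in> hom (functor_cat C D) G H"
      "\<zeta> \<in> hom (functor_cat C D) H J"
    then have e: "is_nattrans C D \<eta>" "nsrc \<eta> = F" "ntgt \<eta> = G"
      and t: "is_nattrans C D \<theta>" "nsrc \<theta> = G" "ntgt \<theta> = H"
      and z: "is_nattrans C D \<zeta>" "nsrc \<zeta> = H" "ntgt \<zeta> = J"
      by (auto simp: hom_def functor_cat_def)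
    have "Cmp D (ncomp \<zeta> x) (Cmp D (ncomp \<theta> x) (ncomp \<eta> x)) =
          Cmp D (Cmp D (ncomp \<zeta> x) (ncomp \<theta> x)) (ncomp \<eta> x)" if x: "x \<in> Obj C" for x
      using D.Cmp_assoc ncomp[OF e(1) x] ncomp[OF t(1) x] ncomp[OF z(1) x] e t z by metis
    then show "Cmp (functor_cat C D) \<zeta> (Cmp (functor_cat C D) \<theta> \<eta>) =
               Cmp (functor_cat C D) (Cmp (functor_cat C D) \<zeta> \<theta>) \<eta>"
      by (simp add: functor_cat_def cong: restrict_cong)
  qed
qed

lemma category_Core:
  assumes "category C"
  shows "category (Core C)"
proof -
  interpret category C by fact
  have homC: "f \<in> hom (Core C) x y \<longleftrightarrow> f \<in> hom C x y \<and> iso C f" for f x y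
    by (auto simp: Core_def hom_def)
  have inv: "iso C f \<longleftrightarrow> (\<exists>g \<in> hom C y x. Cmp C g f = Ident C x \<and> Cmp C f g = Ident C y)"
    if "f \<in> hom C x y" for f x y
    using that by (auto simp: iso_def inverse_arrows_def hom_def)
  have Cmp_iso: "iso C (Cmp C g f)"
    if f: "f \<in> hom C x y" "iso C f" and g: "g \<in> hom C y z" "iso C g" for f g x y z
  proof -
    obtain f' where f': "f' \<in> hom C y x" "Cmp C f' f = Ident C x" "Cmp C f f' = Ident C y"
      using f inv by meson
    obtain g' where g': "g' \<in> hom C z y" "Cmp C g' g = Ident C y" "Cmp C g g' = Ident C z"
      using g inv by meson
    have "Cmp C (Cmp C f' g') (Cmp C g f) = Cmp C f' (Cmp C (Cmp C g' g) f)"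
      using Cmp_assoc[OF f(1) g(1) g'(1)] Cmp_assoc[OF Cmp_hom[OF f(1) g(1)] g'(1) f'(1)] by simp
    moreover have "Cmp C (Cmp C g f) (Cmp C f' g') = Cmp C g (Cmp C (Cmp C f f') g')"
      using Cmp_assoc[OF g'(1) f'(1) f(1)] Cmp_assoc[OF Cmp_hom[OF g'(1) f'(1)] f(1) g(1)] by simp
    ultimately show ?thesis
      using inv[OF Cmp_hom[OF f(1) g(1)]] Cmp_hom[OF g'(1) f'(1)] f' g'
        Cmp_Ident_left[OF f(1)] Cmp_Ident_left[OF g'(1)] by auto
  qed
  have Ident_iso: "iso C (Ident C x)" if "x \<in> Obj C" for x
    using inv[OF Ident_hom[OF that]] Ident_hom[OF that] Cmp_Ident_left[OF Ident_hom[OF that]] by blast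
  have [simp]: "Obj (Core C) = Obj C" "Dom (Core C) = Dom C" "Cod (Core C) = Cod C"
    "Ident (Core C) = Ident C" "Cmp (Core C) = Cmp C" "Arr (Core C) = {f \<in> Arr C. iso C f}"
    by (simp_all add: Core_def)
  show ?thesis
    by unfold_locales
      (auto simp: homC Dom_Obj Cod_Obj Ident_hom Ident_iso Cmp_Ident_left Cmp_Ident_right
        intro: Cmp_hom Cmp_iso Cmp_assoc)
qed

lemma category_quotient_parallel:
  assumes "category C"
  shows "category (quotient_cat C (parallel C))"
    and "\<And>f. f \<in> Arr C \<Longrightarrow> parallel C `` {f} = hom C (Dom C f) (Cod C f)"
    and "\<And>X x y. X \<in> hom (quotient_cat C (parallel C)) x y \<longleftrightarrow> X = hom C x y \<and> hom C x y \<noteq> {}"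
proof -
  interpret category C by fact
  let ?Q = "quotient_cat C (parallel C)"
  have cls: "parallel C `` {f} = hom C (Dom C f) (Cod C f)" if "f \<in> Arr C" for f
    using that by (auto simp: parallel_def hom_def)
  then show "\<And>f. f \<in> Arr C \<Longrightarrow> parallel C `` {f} = hom C (Dom C f) (Cod C f)" .
  have DC: "the_elem (Dom C ` hom C x y) = x" "the_elem (Cod C ` hom C x y) = y"
    if "hom C x y \<noteq> {}" for x y
  proof -
    have "Dom C ` hom C x y = {x}" "Cod C ` hom C x y = {y}"
      using that by (force simp: hom_def)+
    then show "the_elem (Dom C ` hom C x y) = x" "the_elem (Cod C ` hom C x y) = y" by simp_all
  qed
  have Arr: "X \<in> Arr ?Q \<longleftrightarrow> (\<exists>x y. X = hom C x y \<and> hom C x y \<noteq> {})" for X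
  proof
    assume "X \<in> Arr ?Q"
    then obtain f where f: "f \<in> Arr C" "X = parallel C `` {f}"
      by (auto simp: quotient_cat_def elim: quotientE)
    then show "\<exists>x y. X = hom C x y \<and> hom C x y \<noteq> {}"
      using cls[OF f(1)] by (auto simp: hom_def)
  next
    assume "\<exists>x y. X = hom C x y \<and> hom C x y \<noteq> {}"
    then obtain x y f where f: "X = hom C x y" "f \<in> hom C x y" by blast
    then have "f \<in> Arr C" "parallel C `` {f} = X" using cls[of f] by (auto simp: hom_def)
    then show "X \<in> Arr ?Q" by (auto simp: quotient_cat_def quotient_def)
  qed
  have homQ: "X \<in> hom ?Q x y \<longleftrightarrow> X = hom C x y \<and> hom C x y \<noteq> {}" for X x y
  proof -
    have "X \<in> hom ?Q x y \<longleftrightarrow> X \<in> Arr ?Q \<and> the_elem (Dom C ` X) = x \<and> the_elem (Cod C ` X) = y"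
      unfolding hom_def[of ?Q] by (simp add: quotient_cat_def)
    then show ?thesis using Arr DC by metis
  qed
  then show "\<And>X x y. X \<in> hom ?Q x y \<longleftrightarrow> X = hom C x y \<and> hom C x y \<noteq> {}" .
  have homArr: "X \<in> Arr ?Q \<Longrightarrow> X \<in> hom ?Q (Dom ?Q X) (Cod ?Q X)" for X
    by (simp add: hom_def)
  have ObjQ: "Dom ?Q X \<in> Obj C" "Cod ?Q X \<in> Obj C" if "X \<in> Arr ?Q" for X
  proof -
    note X = that
    obtain f where "f \<in> hom C (Dom ?Q X) (Cod ?Q X)"
      using homArr[OF X] homQ[of X "Dom ?Q X" "Cod ?Q X"] by blast
    then have f: "f \<in> Arr C" "Dom C f = Dom ?Q X" "Cod C f = Cod ?Q X"
      by (simp_all add: hom_def[of C])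
    show "Dom ?Q X \<in> Obj C" using Dom_Obj[OF f(1)] f(2) by simp
    show "Cod ?Q X \<in> Obj C" using Cod_Obj[OF f(1)] f(3) by simp
  qed
  have CmpQ: "Cmp ?Q Y X = hom C x z" "hom C x z \<noteq> {}"
    if "X \<in> hom ?Q x y" "Y \<in> hom ?Q y z" for X Y x y z
  proof -
    have ne: "X = hom C x y" "Y = hom C y z" "X \<noteq> {}" "Y \<noteq> {}" using that homQ by auto
    have "parallel C `` {Cmp C g f} = hom C x z" if "f \<in> X" "g \<in> Y" for f g
    proof -
      have "Cmp C g f \<in> hom C x z" using Cmp_hom that ne by blast
      then show ?thesis using cls[of "Cmp C g f"] by (simp add: hom_def)
    qed
    then show "Cmp ?Q Y X = hom C x z" using ne by (auto simp: quotient_cat_def)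
    obtain f g where "f \<in> hom C x y" "g \<in> hom C y z" using ne by blast
    then show "hom C x z \<noteq> {}" using Cmp_hom by blast
  qed
  have IdQ: "Ident ?Q x = hom C x x" "hom C x x \<noteq> {}" if "x \<in> Obj C" for x
    using Ident_hom[OF that] cls[of "Ident C x"] by (auto simp: quotient_cat_def hom_def)
  have homObj: "x \<in> Obj C \<and> y \<in> Obj C" if "X \<in> hom ?Q x y" for X x y
  proof -
    have "hom C x y \<noteq> {}" using that homQ[of X x y] by simp
    then obtain f where "f \<in> Arr C" "Dom C f = x" "Cod C f = y" by (auto simp: hom_def)
    then show ?thesis using Dom_Obj[of f] Cod_Obj[of f] by simp
  qed
  have IdhomQ: "Ident ?Q x \<in> hom ?Q x x" if "x \<in> Obj C" for x
    using IdQ[OF that] homQ by metis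
  have CmphomQ: "Cmp ?Q Y X \<in> hom ?Q x z" if "X \<in> hom ?Q x y" "Y \<in> hom ?Q y z" for X Y x y z
    using CmpQ[OF that] homQ by metis
  have thin: "X = Y" if "X \<in> hom ?Q x y" "Y \<in> hom ?Q x y" for X Y x y
    using that homQ by metis
  have [simp]: "Obj ?Q = Obj C" by (simp add: quotient_cat_def)
  show "category ?Q"
  proof
    fix f x y assume f: "f \<in> hom ?Q x y"
    show "Cmp ?Q f (Ident ?Q x) = f"
      by (rule thin[OF CmphomQ[OF IdhomQ f] f]) (simp add: homObj[OF f])
    show "Cmp ?Q (Ident ?Q y) f = f"
      by (rule thin[OF CmphomQ[OF f IdhomQ] f]) (simp add: homObj[OF f])
  next
    fix f g h w x y z
    assume f: "f \<in> hom ?Q w x" and g: "g \<in> hom ?Q x y" and h: "h \<in> hom ?Q y z"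
    show "Cmp ?Q h (Cmp ?Q g f) = Cmp ?Q (Cmp ?Q h g) f"
      by (rule thin[OF CmphomQ[OF CmphomQ[OF f g] h] CmphomQ[OF f CmphomQ[OF g h]]])
  next
    fix f assume f: "f \<in> Arr ?Q"
    show "Dom ?Q f \<in> Obj ?Q" "Cod ?Q f \<in> Obj ?Q" using ObjQ[OF f] by simp_all
  next
    fix x assume "x \<in> Obj ?Q"
    then show "Ident ?Q x \<in> hom ?Q x x" using IdhomQ by simp
  next
    fix f g x y z assume "f \<in> hom ?Q x y" "g \<in> hom ?Q y z"
    then show "Cmp ?Q g f \<in> hom ?Q x z" by (rule CmphomQ)
  qed
qed

context lifecycle_setting
begin

lemma vertices_Cmp:
  assumes "last (vertices p) = fst q"
  shows "vertices (fst p, snd p @ snd q) = vertices p @ tl (vertices q)"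
    and "last (vertices (fst p, snd p @ snd q)) = last (vertices q)"
  using assms by (auto simp: vertices_def last_map split: if_splits)

lemma vertices_states:
  assumes "is_spath D U R p"
  shows "set (vertices p) \<subseteq> states D"
proof -
  have "vertices p ! i \<in> states D" if "i < length (vertices p)" for i
  proof (cases i)
    case 0 then show ?thesis using assms by (simp add: is_spath_def vertices_def)
  next
    case (Suc j)
    then have "j < path_length p" using that by (simp add: vertices_def path_length_def)
    then show ?thesis using assms R_states Suc unfolding is_spath_def by blast
  qed
  then show ?thesis by (metis in_set_conv_nth subsetI)
qed

lemma is_spath_Cmp:
  assumes p: "is_spath D U R p" and q: "is_spath D U R q" and pq: "last (vertices p) = fst q"
  shows "is_spath D U R (fst p, snd p @ snd q)"
proof -
  let ?r = "(fst p, snd p @ snd q)"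
  let ?n = "path_length p"
  have lv: "length (vertices p) = Suc ?n" "length (vertices q) = Suc (path_length q)"
    by (simp_all add: vertices_def path_length_def)
  have v1: "vertices ?r ! i = vertices p ! i" if "i \<le> ?n" for i
    using that lv by (simp add: vertices_Cmp(1)[OF pq] nth_append)
  have v2: "vertices ?r ! (?n + i) = vertices q ! i" if "i \<le> path_length q" for i
  proof (cases i)
    case 0
    have "vertices p \<noteq> []" by (simp add: vertices_def)
    then have "vertices p ! ?n = last (vertices p)" using lv by (simp add: last_conv_nth)
    then show ?thesis using 0 v1[of ?n] pq by (simp add: vertices_def)
  next
    case (Suc j)
    then show ?thesis using that lv by (simp add: vertices_Cmp(1)[OF pq] nth_append nth_tl)
  qed
  have "fst (snd ?r ! i) \<in> U \<and> (vertices ?r ! i, vertices ?r ! Suc i) \<in> R (fst (snd ?r ! i))"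
    if i: "i < path_length ?r" for i
  proof (cases "i < ?n")
    case True
    then show ?thesis using p v1[of i] v1[of "Suc i"]
      by (simp add: is_spath_def path_length_def nth_append)
  next
    case False
    then obtain j where j: "i = ?n + j" by (metis le_add_diff_inverse not_less)
    then have "j < path_length q" using i by (simp add: path_length_def)
    moreover have "snd ?r ! i = snd q ! j" using j by (simp add: path_length_def nth_append)
    ultimately show ?thesis using q v2[of j] v2[of "Suc j"] j by (simp add: is_spath_def)
  qed
  then show ?thesis using p by (simp add: is_spath_def)
qed

lemma category_Path: "category (Path D U R)"
proof
  show "Cod (Path D U R) f \<in> Obj (Path D U R)" if "f \<in> Arr (Path D U R)" for f
  proof -
    have "last (vertices f) \<in> set (vertices f)" by (rule last_in_set) (simp add: vertices_def)
    then show ?thesis using that vertices_states[of f] by (auto simp: Path_def)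
  qed
  show "Cmp (Path D U R) g f \<in> hom (Path D U R) x z"
    if "f \<in> hom (Path D U R) x y" "g \<in> hom (Path D U R) y z" for f g x y z
    using that is_spath_Cmp[of f g] vertices_Cmp(2)[of f g] by (auto simp: Path_def hom_def)
qed (auto simp: Path_def hom_def is_spath_def path_length_def vertices_def prod_eq_iff)

lemma category_Path_tau: "category (Path_tau D U R)"
proof -
  interpret P: category "Path D U R" by (rule category_Path)
  have homP: "f \<in> hom (Path_tau D U R) x y \<longleftrightarrow> f \<in> hom (Path D U R) x y \<and> level_preserving f" for f x y
    by (auto simp: Path_tau_def hom_def)
  have lp: "level_preserving (Cmp (Path D U R) g f)"
    if "f \<in> hom (Path D U R) x y" "g \<in> hom (Path D U R) y z" "level_preserving f" "level_preserving g"
    for f g x y z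
  proof -
    have fg: "last (vertices f) = fst g" using that by (auto simp: hom_def Path_def)
    have "last (vertices f) \<in> set (vertices f)" by (rule last_in_set) (simp add: vertices_def)
    then have "tau (fst g) = tau (fst f)" using that(3) fg by (simp add: level_preserving_def)
    moreover have "set (tl (vertices g)) \<subseteq> set (vertices g)" by (simp add: vertices_def subset_insertI)
    ultimately show ?thesis using that(3,4)
      by (auto simp: level_preserving_def Path_def vertices_Cmp(1)[OF fg, simplified])
  qed
  have lpI: "level_preserving (Ident (Path D U R) x)" for x
    by (simp add: level_preserving_def Path_def vertices_def)
  have [simp]: "Obj (Path_tau D U R) = Obj (Path D U R)" "Dom (Path_tau D U R) = Dom (Path D U R)"
    "Cod (Path_tau D U R) = Cod (Path D U R)" "Ident (Path_tau D U R) = Ident (Path D U R)"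
    "Cmp (Path_tau D U R) = Cmp (Path D U R)"
    "Arr (Path_tau D U R) = {p \<in> Arr (Path D U R). level_preserving p}"
    by (simp_all add: Path_tau_def)
  show ?thesis
    by unfold_locales
      (auto simp: homP lpI P.Dom_Obj P.Cod_Obj P.Ident_hom P.Cmp_Ident_left P.Cmp_Ident_right
        intro: P.Cmp_hom lp P.Cmp_assoc)
qed

lemma category_Sys: "category (Sys D U R)"
  unfolding Sys_def by (rule category_quotient_parallel(1)[OF category_Path_tau])

lemma category_Traj: "category (Traj D U R t\<^sub>0 T Tok prof)"
proof -
  let ?F = "functor_cat (interval_cat t\<^sub>0 T) (Sys D U R)"
  let ?H = "realized_histories D U R t\<^sub>0 T Tok prof"
  let ?ts = "\<lambda>t h. \<exists>p. time_synchronous_rep D U R t\<^sub>0 T Tok prof t h p"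
  interpret F: category ?F
    by (intro category_functor_cat category_interval_cat category_Sys)
  interpret P: category "Path_tau D U R" by (rule category_Path_tau)
  interpret S: category "Sys D U R" by (rule category_Sys)
  note homS = category_quotient_parallel(3)[OF category_Path_tau, folded Sys_def]
  let ?sync = "\<lambda>\<eta>. \<forall>t \<in> {t\<^sub>0..T}. ?ts t (ncomp \<eta> t)"
  have homT: "f \<in> hom (Traj D U R t\<^sub>0 T Tok prof) A B \<longleftrightarrow> f \<in> hom ?F A B \<and> A \<in> ?H \<and> B \<in> ?H \<and> ?sync f"
    for f A B
    by (auto simp: Traj_def hom_def functor_cat_def)
  have HF: "A \<in> Obj ?F" if "A \<in> ?H" for A
    using that by (simp add: functor_cat_def realized_histories_def is_history_def)
  have tsI: "?ts t h \<longleftrightarrow> (\<exists>p \<in> hom (Path_tau D U R) x y. set (vertices p) \<subseteq>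
       realized_states D U R t\<^sub>0 T Tok prof t)" if "h \<in> hom (Sys D U R) x y" for h x y t
  proof -
    have "h \<in> Arr (Sys D U R)" using that by (simp add: hom_def)
    moreover have "h = hom (Path_tau D U R) x y" using that homS by blast
    ultimately show ?thesis
      unfolding time_synchronous_rep_def represents_def by (auto simp: hom_def)
  qed
  have syncI: "?sync (Ident ?F A)" if A: "A \<in> ?H" for A
  proof
    fix t assume t: "t \<in> {t\<^sub>0..T}"
    have x: "fobj A t \<in> Obj (Sys D U R)"
      using HF[OF A] t by (auto simp: functor_cat_def is_functor_def interval_cat_def)
    have "Ident (Path_tau D U R) (fobj A t) \<in> hom (Path_tau D U R) (fobj A t) (fobj A t)"
      using P.Ident_hom x by (simp add: Sys_def quotient_cat_def)
    moreover have "set (vertices (Ident (Path_tau D U R) (fobj A t))) \<subseteq>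
        realized_states D U R t\<^sub>0 T Tok prof t"
      using A by (auto simp: Path_tau_def Path_def vertices_def realized_states_def)
    ultimately have "?ts t (Ident (Sys D U R) (fobj A t))"
      using tsI[OF S.Ident_hom[OF x]] by blast
    then show "?ts t (ncomp (Ident ?F A) t)"
      using t by (simp add: functor_cat_def interval_cat_def)
  qed
  have syncC: "?sync (Cmp ?F g f)"
    if f: "f \<in> hom ?F A B" "?sync f" and g: "g \<in> hom ?F B C" "?sync g" for f g A B C
  proof
    fix t assume t: "t \<in> {t\<^sub>0..T}"
    have ft: "ncomp f t \<in> hom (Sys D U R) (fobj A t) (fobj B t)"
      and gt: "ncomp g t \<in> hom (Sys D U R) (fobj B t) (fobj C t)"
      using f(1) g(1) t unfolding hom_def[of ?F]
      by (auto simp: functor_cat_def is_nattrans_def interval_cat_def)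
    obtain p where p: "p \<in> hom (Path_tau D U R) (fobj A t) (fobj B t)"
      "set (vertices p) \<subseteq> realized_states D U R t\<^sub>0 T Tok prof t"
      using f(2) t tsI[OF ft] by blast
    obtain q where q: "q \<in> hom (Path_tau D U R) (fobj B t) (fobj C t)"
      "set (vertices q) \<subseteq> realized_states D U R t\<^sub>0 T Tok prof t"
      using g(2) t tsI[OF gt] by blast
    have pq: "last (vertices p) = fst q" using p q by (auto simp: hom_def Path_tau_def Path_def)
    have "set (tl (vertices q)) \<subseteq> set (vertices q)" by (simp add: vertices_def subset_insertI)
    then have "set (vertices (Cmp (Path_tau D U R) q p)) \<subseteq> realized_states D U R t\<^sub>0 T Tok prof t"
      using p(2) q(2) by (auto simp: Path_tau_def Path_def vertices_Cmp(1)[OF pq, simplified])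
    then have "?ts t (Cmp (Sys D U R) (ncomp g t) (ncomp f t))"
      using tsI[OF S.Cmp_hom[OF ft gt]] P.Cmp_hom[OF p(1) q(1)] by blast
    then show "?ts t (ncomp (Cmp ?F g f) t)"
      using t by (simp add: functor_cat_def interval_cat_def)
  qed
  have [simp]: "Obj (Traj D U R t\<^sub>0 T Tok prof) = ?H"
    "Ident (Traj D U R t\<^sub>0 T Tok prof) = Ident ?F" "Cmp (Traj D U R t\<^sub>0 T Tok prof) = Cmp ?F"
    by (simp_all add: Traj_def functor_cat_def)
  show ?thesis
  proof
    fix f assume "f \<in> Arr (Traj D U R t\<^sub>0 T Tok prof)"
    then show "Dom (Traj D U R t\<^sub>0 T Tok prof) f \<in> Obj (Traj D U R t\<^sub>0 T Tok prof)"
      "Cod (Traj D U R t\<^sub>0 T Tok prof) f \<in> Obj (Traj D U R t\<^sub>0 T Tok prof)"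
      by (auto simp: Traj_def functor_cat_def)
  next
    fix A assume "A \<in> Obj (Traj D U R t\<^sub>0 T Tok prof)"
    then have A: "A \<in> ?H" by simp
    then show "Ident (Traj D U R t\<^sub>0 T Tok prof) A \<in> hom (Traj D U R t\<^sub>0 T Tok prof) A A"
      using F.Ident_hom[OF HF[OF A]] syncI[OF A] unfolding homT by simp
  next
    fix f g A B C
    assume "f \<in> hom (Traj D U R t\<^sub>0 T Tok prof) A B" "g \<in> hom (Traj D U R t\<^sub>0 T Tok prof) B C"
    then have f: "f \<in> hom ?F A B" "?sync f" "A \<in> ?H" and g: "g \<in> hom ?F B C" "?sync g" "C \<in> ?H"
      unfolding homT by blast+
    have "Cmp ?F g f \<in> hom (Traj D U R t\<^sub>0 T Tok prof) A C"
      unfolding homT using F.Cmp_hom[OF f(1) g(1)] syncC[OF f(1,2) g(1,2)] f(3) g(3) by blast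
    then show "Cmp (Traj D U R t\<^sub>0 T Tok prof) g f \<in> hom (Traj D U R t\<^sub>0 T Tok prof) A C"
      by simp
  next
    fix f A B assume "f \<in> hom (Traj D U R t\<^sub>0 T Tok prof) A B"
    then have f: "f \<in> hom ?F A B" unfolding homT by blast
    show "Cmp (Traj D U R t\<^sub>0 T Tok prof) f (Ident (Traj D U R t\<^sub>0 T Tok prof) A) = f"
      "Cmp (Traj D U R t\<^sub>0 T Tok prof) (Ident (Traj D U R t\<^sub>0 T Tok prof) B) f = f"
      using F.Cmp_Ident_left[OF f] F.Cmp_Ident_right[OF f] by simp_all
  next
    fix f g h A B C E
    assume "f \<in> hom (Traj D U R t\<^sub>0 T Tok prof) A B" "g \<in> hom (Traj D U R t\<^sub>0 T Tok prof) B C"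
      "h \<in> hom (Traj D U R t\<^sub>0 T Tok prof) C E"
    then have f: "f \<in> hom ?F A B" "g \<in> hom ?F B C" "h \<in> hom ?F C E"
      unfolding homT by blast+
    show "Cmp (Traj D U R t\<^sub>0 T Tok prof) h (Cmp (Traj D U R t\<^sub>0 T Tok prof) g f) =
               Cmp (Traj D U R t\<^sub>0 T Tok prof) (Cmp (Traj D U R t\<^sub>0 T Tok prof) h g) f"
      using F.Cmp_assoc[OF f] by simp
  qed
qed

end

end

theory Submission
  imports Defs
begin

text \<open>
  Passing to the quotient by all parallel arrows makes \<open>Sys\<close> a thin category, i.e.\ a preorder: the
  unique candidate for a morphism \<open>x \<rightarrow> y\<close> is the set of all level-preserving paths from \<open>x\<close> to
  \<open>y\<close>, and it is a morphism as soon as one such path exists (\<open>hom_Sys_iff\<close>). Everything follows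
  from this.

  In a thin category every equation between parallel arrows holds, so an arrow \<open>x \<rightarrow> y\<close> is
  inverted by any arrow \<open>y \<rightarrow> x\<close> whatsoever (\<open>inverse_arrows_iff\<close>), and \<open>x\<close> and \<open>y\<close> are isomorphic
  precisely when there are arrows both ways. For a history, the arrow from the earlier to the later
  state comes for free, so strong diachronic identity amounts to an arrow back in time; and all
  arrows of the history being isomorphisms is the same as the history landing in the core. For two
  histories at one time, any two opposite time-synchronous arrows are already mutually inverse.

  Naturality squares are equations between parallel arrows, too. A morphism \<open>A \<rightarrow> B\<close> of \<open>Traj\<close> is
  therefore an unconstrained family of time-synchronous arrows, one for each time
  (\<open>hom_Traj_nonempty_iff\<close>), and \<open>Traj\<close> is again thin. Hence an isomorphism in \<open>Traj\<close> is a pair of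
  opposite morphisms, which can be assembled from the separate times.

  The weak identities hold because a level-preserving path has endpoints of equal level, and a
  morphism of \<open>Sys\<close> is a nonempty set of such paths (\<open>hom_Sys_weak_identity\<close>).
\<close>

section \<open>Thin categories\<close>

locale thin_category = category +
  assumes thin: "\<lbrakk>f \<in> hom C x y; g \<in> hom C x y\<rbrakk> \<Longrightarrow> f = g"
begin

text \<open>Both composites are endomorphisms, and an endomorphism in a thin category is an identity.\<close>

lemma inverse_arrows_iff:
  assumes f: "f \<in> hom C x y"
  shows "inverse_arrows C f g \<longleftrightarrow> g \<in> hom C y x"
proof -
  have xy: "f \<in> Arr C" "Dom C f = x" "Cod C f = y" using f by (simp_all add: hom_def)
  then have obj: "x \<in> Obj C" "y \<in> Obj C" using Dom_Obj Cod_Obj by blast+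
  have "Cmp C g f = Ident C x" "Cmp C f g = Ident C y" if g: "g \<in> hom C y x"
    using thin[OF Cmp_hom[OF f g] Ident_hom[OF obj(1)]] thin[OF Cmp_hom[OF g f] Ident_hom[OF obj(2)]]
    by simp_all
  then show ?thesis unfolding inverse_arrows_def xy using xy(1) by blast
qed

lemma iso_iff:
  assumes "f \<in> hom C x y"
  shows "iso C f \<longleftrightarrow> hom C y x \<noteq> {}"
  unfolding iso_def inverse_arrows_iff[OF assms] by blast

lemma isomorphic_iff: "isomorphic C x y \<longleftrightarrow> hom C x y \<noteq> {} \<and> hom C y x \<noteq> {}"
  unfolding isomorphic_def using iso_iff by blast

text \<open>The two sides of a naturality square are parallel, so the square commutes automatically.\<close>

lemma is_nattransI:
  assumes J: "category J" and F: "is_functor J C F" and G: "is_functor J C G"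
    and c: "\<And>j. j \<in> Obj J \<Longrightarrow> c j \<in> hom C (fobj F j) (fobj G j)"
  shows "is_nattrans J C \<lparr>nsrc = F, ntgt = G, ncomp = restrict c (Obj J)\<rparr>"
proof -
  interpret J: category J by fact
  have "Cmp C (c (Cod J f)) (farr F f) = Cmp C (farr G f) (c (Dom J f))" if f: "f \<in> Arr J" for f
  proof (rule thin)
    have Ff: "farr F f \<in> hom C (fobj F (Dom J f)) (fobj F (Cod J f))"
      and Gf: "farr G f \<in> hom C (fobj G (Dom J f)) (fobj G (Cod J f))"
      using F G f by (simp_all add: is_functor_def)
    show "Cmp C (c (Cod J f)) (farr F f) \<in> hom C (fobj F (Dom J f)) (fobj G (Cod J f))"
      by (rule Cmp_hom[OF Ff c[OF J.Cod_Obj[OF f]]])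
    show "Cmp C (farr G f) (c (Dom J f)) \<in> hom C (fobj F (Dom J f)) (fobj G (Cod J f))"
      by (rule Cmp_hom[OF c[OF J.Dom_Obj[OF f]] Gf])
  qed
  then show ?thesis
    using F G c by (simp add: is_nattrans_def J.Dom_Obj J.Cod_Obj)
qed

lemma nattrans_unique:
  fixes \<eta> \<theta> :: "('p, 'q, 'a, 'b) nattrans"
  assumes \<eta>: "is_nattrans J C \<eta>" and \<theta>: "is_nattrans J C \<theta>"
    and st: "nsrc \<eta> = nsrc \<theta>" "ntgt \<eta> = ntgt \<theta>"
  shows "\<eta> = \<theta>"
proof -
  have "ncomp \<eta> x = ncomp \<theta> x" if "x \<in> Obj J" for x
    using \<eta> \<theta> that unfolding is_nattrans_def st by (blast intro: thin)
  then have "ncomp \<eta> = ncomp \<theta>"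
    using \<eta> \<theta> by (auto simp: is_nattrans_def intro: extensionalityI)
  then show ?thesis using st by simp
qed

end


section \<open>Functors into the core\<close>

text \<open>
  The inclusion is the identity on the values of a functor, so the factorization, if there is one,
  has the same object and arrow maps; only the target shrinks.
\<close>

lemma factors_through_Core_iff:
  assumes F: "is_functor J C F"
  shows "factors_through_inclusion J (Core C) F \<longleftrightarrow> (\<forall>f \<in> Arr J. iso C (farr F f))"
proof
  assume "factors_through_inclusion J (Core C) F"
  then obtain G where G: "is_functor J (Core C) G" and FG: "F = functor_comp J (inclusion (Core C)) G"
    by (auto simp: factors_through_inclusion_def)
  show "\<forall>f \<in> Arr J. iso C (farr F f)"
  proof
    fix f assume f: "f \<in> Arr J"
    then have "farr G f \<in> Arr (Core C)" using G by (auto simp: is_functor_def)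
    then show "iso C (farr F f)"
      using f unfolding FG by (simp add: functor_comp_def inclusion_def Core_def)
  qed
next
  assume iso: "\<forall>f \<in> Arr J. iso C (farr F f)"
  have arr: "farr F f \<in> Arr (Core C)" if "f \<in> Arr J" for f
    using F iso that by (auto simp: is_functor_def Core_def)
  have obj: "fobj F x \<in> Obj (Core C)" if "x \<in> Obj J" for x
    using F that by (auto simp: is_functor_def Core_def)
  have "is_functor J (Core C) F"
    using F iso by (auto simp: is_functor_def Core_def hom_def)
  moreover have "fobj F = fobj (functor_comp J (inclusion (Core C)) F)"
    using F obj by (auto simp: is_functor_def PiE_def functor_comp_def inclusion_def
        intro!: extensionalityI[where A = "Obj J"])
  moreover have "farr F = farr (functor_comp J (inclusion (Core C)) F)"
    using F arr by (auto simp: is_functor_def PiE_def functor_comp_def inclusion_def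
        intro!: extensionalityI[where A = "Arr J"])
  ultimately show "factors_through_inclusion J (Core C) F"
    unfolding factors_through_inclusion_def by (metis functr.equality old.unit.exhaust)
qed


section \<open>The state category is thin\<close>

lemma is_functor_interval_hom:
  assumes "is_functor (interval_cat t\<^sub>0 T) C A" "t \<in> {t\<^sub>0..T}" "t' \<in> {t\<^sub>0..T}" "t \<le> t'"
  shows "farr A (t, t') \<in> hom C (fobj A t) (fobj A t')"
  using assms by (force simp: is_functor_def interval_cat_def)

lemma Obj_interval_cat [simp]: "Obj (interval_cat t\<^sub>0 T) = {t\<^sub>0..T}"
  by (simp add: interval_cat_def)

context lifecycle_setting
begin

lemma hom_Sys_iff:
  "h \<in> hom (Sys D U R) x y \<longleftrightarrow>
     h = hom (Path_tau D U R) x y \<and> hom (Path_tau D U R) x y \<noteq> {}"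
  unfolding Sys_def by (rule category_quotient_parallel(3)[OF category_Path_tau])

lemma thin_category_Sys: "thin_category (Sys D U R)"
proof -
  interpret category "Sys D U R" by (rule category_Sys)
  show ?thesis by unfold_locales (simp add: hom_Sys_iff)
qed

lemma hom_Sys_weak_identity:
  assumes "h \<in> hom (Sys D U R) x y"
  shows "weak_identity x y"
proof -
  obtain p where "p \<in> hom (Path_tau D U R) x y"
    using assms by (auto simp: hom_Sys_iff)
  then have p: "level_preserving p" "fst p = x" "last (vertices p) = y"
    by (auto simp: hom_def Path_tau_def Path_def)
  have "last (vertices p) \<in> set (vertices p)" by (rule last_in_set) (simp add: vertices_def)
  then show ?thesis using p by (auto simp: level_preserving_def weak_identity_def)
qed

lemma strong_identity_iff:
  "strong_identity D U R x y \<longleftrightarrow> hom (Sys D U R) x y \<noteq> {} \<and> hom (Sys D U R) y x \<noteq> {}"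
  unfolding strong_identity_def by (rule thin_category.isomorphic_iff[OF thin_category_Sys])

section \<open>Diachronic identity\<close>

lemma realized_is_functor:
  assumes "A \<in> realized_histories D U R t\<^sub>0 T Tok prof"
  shows "is_functor (interval_cat t\<^sub>0 T) (Sys D U R) A"
  using assms by (simp add: realized_histories_def is_history_def)

lemma functor_weak_diachronic_identity:
  assumes "is_functor (interval_cat t\<^sub>0 T) (Sys D U R) A"
  shows "weak_diachronic_identity_throughout t\<^sub>0 T A"
  unfolding weak_diachronic_identity_throughout_def
  using is_functor_interval_hom[OF assms] hom_Sys_weak_identity by blast

lemma strong_diachronic_identity_iff:
  assumes "is_functor (interval_cat t\<^sub>0 T) (Sys D U R) A"
    and "t \<in> {t\<^sub>0..T}" "t' \<in> {t\<^sub>0..T}" "t \<le> t'"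
  shows "strong_identity D U R (fobj A t) (fobj A t') \<longleftrightarrow>
      (\<exists>f. f \<in> hom (Sys D U R) (fobj A t') (fobj A t))"
  unfolding strong_identity_iff using is_functor_interval_hom[OF assms] by blast

text \<open>
  Thinness is what turns the bare existence of some isomorphism between the two states into
  invertibility of the arrow that belongs to the history.
\<close>

lemma strong_diachronic_identity_throughout_iff:
  assumes A: "is_functor (interval_cat t\<^sub>0 T) (Sys D U R) A"
  shows "strong_diachronic_identity_throughout D U R t\<^sub>0 T A \<longleftrightarrow>
      factors_through_inclusion (interval_cat t\<^sub>0 T) (Core (Sys D U R)) A"
proof -
  have "strong_identity D U R (fobj A t) (fobj A t') \<longleftrightarrow> iso (Sys D U R) (farr A (t, t'))"
    if "t \<in> {t\<^sub>0..T}" "t' \<in> {t\<^sub>0..T}" "t \<le> t'" for t t'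
    using strong_diachronic_identity_iff[OF A that]
      thin_category.iso_iff[OF thin_category_Sys is_functor_interval_hom[OF A that]] by blast
  then show ?thesis
    unfolding factors_through_Core_iff[OF A] strong_diachronic_identity_throughout_def
    by (auto simp: interval_cat_def)
qed


section \<open>Synchronic identity and trajectories\<close>

definition sync_arrow :: "real \<Rightarrow> state \<Rightarrow> state \<Rightarrow> 'r spath set \<Rightarrow> bool" where
  "sync_arrow t x y h \<longleftrightarrow> h \<in> hom (Sys D U R) x y \<and>
     (\<exists>p. time_synchronous_rep D U R t\<^sub>0 T Tok prof t h p)"

lemma strong_synchronic_identity_iff:
  "strong_synchronic_identity D U R t\<^sub>0 T Tok prof A B t \<longleftrightarrow>
     (\<exists>h. sync_arrow t (fobj A t) (fobj B t) h) \<and> (\<exists>k. sync_arrow t (fobj B t) (fobj A t) k)"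
  unfolding strong_synchronic_identity_def sync_arrow_def
  using thin_category.inverse_arrows_iff[OF thin_category_Sys] by blast

lemma hom_Traj_iff:
  "\<eta> \<in> hom (Traj D U R t\<^sub>0 T Tok prof) A B \<longleftrightarrow>
     is_nattrans (interval_cat t\<^sub>0 T) (Sys D U R) \<eta> \<and> nsrc \<eta> = A \<and> ntgt \<eta> = B \<and>
     A \<in> realized_histories D U R t\<^sub>0 T Tok prof \<and> B \<in> realized_histories D U R t\<^sub>0 T Tok prof \<and>
     (\<forall>t \<in> {t\<^sub>0..T}. sync_arrow t (fobj A t) (fobj B t) (ncomp \<eta> t))"
  unfolding hom_def[of "Traj D U R t\<^sub>0 T Tok prof"]
  by (auto simp: Traj_def functor_cat_def is_nattrans_def sync_arrow_def)

lemma thin_category_Traj: "thin_category (Traj D U R t\<^sub>0 T Tok prof)"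
proof -
  interpret category "Traj D U R t\<^sub>0 T Tok prof" by (rule category_Traj)
  show ?thesis
    by unfold_locales
      (auto simp: hom_Traj_iff intro: thin_category.nattrans_unique[OF thin_category_Sys])
qed

text \<open>
  As naturality is automatic, time-synchronous arrows chosen independently at all times form a
  morphism of trajectories.
\<close>

lemma hom_Traj_nonempty_iff:
  assumes A: "A \<in> realized_histories D U R t\<^sub>0 T Tok prof"
    and B: "B \<in> realized_histories D U R t\<^sub>0 T Tok prof"
  shows "hom (Traj D U R t\<^sub>0 T Tok prof) A B \<noteq> {} \<longleftrightarrow>
      (\<forall>t \<in> {t\<^sub>0..T}. \<exists>h. sync_arrow t (fobj A t) (fobj B t) h)"
proof
  assume "hom (Traj D U R t\<^sub>0 T Tok prof) A B \<noteq> {}"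
  then show "\<forall>t \<in> {t\<^sub>0..T}. \<exists>h. sync_arrow t (fobj A t) (fobj B t) h"
    using hom_Traj_iff by blast
next
  assume "\<forall>t \<in> {t\<^sub>0..T}. \<exists>h. sync_arrow t (fobj A t) (fobj B t) h"
  then obtain c where c: "\<And>t. t \<in> {t\<^sub>0..T} \<Longrightarrow> sync_arrow t (fobj A t) (fobj B t) (c t)"
    by metis
  have "is_nattrans (interval_cat t\<^sub>0 T) (Sys D U R)
      \<lparr>nsrc = A, ntgt = B, ncomp = restrict c (Obj (interval_cat t\<^sub>0 T))\<rparr>"
    by (rule thin_category.is_nattransI[OF thin_category_Sys category_interval_cat
          realized_is_functor[OF A] realized_is_functor[OF B]])
      (use c in \<open>simp add: sync_arrow_def\<close>)
  then have "\<lparr>nsrc = A, ntgt = B, ncomp = restrict c {t\<^sub>0..T}\<rparr> \<in> hom (Traj D U R t\<^sub>0 T Tok prof) A B"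
    using A B c by (simp add: hom_Traj_iff)
  then show "hom (Traj D U R t\<^sub>0 T Tok prof) A B \<noteq> {}" by blast
qed

lemma isomorphic_Traj_iff:
  assumes "A \<in> realized_histories D U R t\<^sub>0 T Tok prof" "B \<in> realized_histories D U R t\<^sub>0 T Tok prof"
  shows "isomorphic (Traj D U R t\<^sub>0 T Tok prof) A B \<longleftrightarrow>
      (\<forall>t \<in> {t\<^sub>0..T}. strong_synchronic_identity D U R t\<^sub>0 T Tok prof A B t)"
  unfolding thin_category.isomorphic_iff[OF thin_category_Traj] strong_synchronic_identity_iff
    hom_Traj_nonempty_iff[OF assms] hom_Traj_nonempty_iff[OF assms(2,1)] by blast

end


section \<open>The identity criteria\<close>

theorem theorem1:
  fixes K :: nat
    and D :: "('f, 'd) type_datum"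
    and U :: "'r set"
    and R :: "'r \<Rightarrow> (state \<times> state) set"
    and t\<^sub>0 T :: real
    and Tok :: "'u set"
    and prof :: "'u \<Rightarrow> real \<Rightarrow> real list"
    and A B :: "'r sys_functor"
  assumes "lifecycle_setting K D U R t\<^sub>0 T Tok prof"
    and "A \<in> Obj (Traj D U R t\<^sub>0 T Tok prof)"
    and "B \<in> Obj (Traj D U R t\<^sub>0 T Tok prof)"
  shows "
    (\<forall>t \<in> {t\<^sub>0..T}. \<forall>t' \<in> {t\<^sub>0..T}. t \<le> t' \<longrightarrow>
       farr A (t, t') \<in> hom (Sys D U R) (fobj A t) (fobj A t') \<and>
       weak_identity (fobj A t) (fobj A t')) \<and>
    (\<forall>H \<in> realized_histories D U R t\<^sub>0 T Tok prof. weak_diachronic_identity_throughout t\<^sub>0 T H) \<and>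
    (\<forall>t \<in> {t\<^sub>0..T}. \<forall>t' \<in> {t\<^sub>0..T}. t \<le> t' \<longrightarrow>
       (strong_identity D U R (fobj A t) (fobj A t') \<longleftrightarrow>
        (\<exists>f. f \<in> hom (Sys D U R) (fobj A t') (fobj A t)))) \<and>
    (strong_diachronic_identity_throughout D U R t\<^sub>0 T A \<longleftrightarrow>
       factors_through_inclusion (interval_cat t\<^sub>0 T) (Core (Sys D U R)) A) \<and>
    (\<forall>t \<in> {t\<^sub>0..T}.
       (\<exists>h \<in> hom (Sys D U R) (fobj A t) (fobj B t).
          \<exists>p. time_synchronous_rep D U R t\<^sub>0 T Tok prof t h p) \<longrightarrow>
       weak_identity (fobj A t) (fobj B t)) \<and>
    ((\<exists>\<eta>. \<eta> \<in> hom (Traj D U R t\<^sub>0 T Tok prof) A B) \<longrightarrow>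
       (\<forall>t \<in> {t\<^sub>0..T}. weak_identity (fobj A t) (fobj B t))) \<and>
    (\<forall>t \<in> {t\<^sub>0..T}.
       strong_synchronic_identity D U R t\<^sub>0 T Tok prof A B t \<longleftrightarrow>
       (\<exists>h \<in> hom (Sys D U R) (fobj A t) (fobj B t).
          \<exists>k \<in> hom (Sys D U R) (fobj B t) (fobj A t).
            (\<exists>p. time_synchronous_rep D U R t\<^sub>0 T Tok prof t h p) \<and>
            (\<exists>p. time_synchronous_rep D U R t\<^sub>0 T Tok prof t k p))) \<and>
    (isomorphic (Traj D U R t\<^sub>0 T Tok prof) A B \<longleftrightarrow>
       (\<forall>t \<in> {t\<^sub>0..T}. strong_synchronic_identity D U R t\<^sub>0 T Tok prof A B t))"
proof -
  interpret lifecycle_setting K D U R t\<^sub>0 T Tok prof by fact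
  have A: "A \<in> realized_histories D U R t\<^sub>0 T Tok prof"
    and B: "B \<in> realized_histories D U R t\<^sub>0 T Tok prof"
    using assms(2,3) by (simp_all add: Traj_def)
  note FA = realized_is_functor[OF A]
  show ?thesis
  proof (intro conjI)
    show "\<forall>t \<in> {t\<^sub>0..T}. \<forall>t' \<in> {t\<^sub>0..T}. t \<le> t' \<longrightarrow>
       farr A (t, t') \<in> hom (Sys D U R) (fobj A t) (fobj A t') \<and>
       weak_identity (fobj A t) (fobj A t')"
      using is_functor_interval_hom[OF FA] hom_Sys_weak_identity by blast
    show "\<forall>H \<in> realized_histories D U R t\<^sub>0 T Tok prof. weak_diachronic_identity_throughout t\<^sub>0 T H"
      using realized_is_functor functor_weak_diachronic_identity by blast
    show "\<forall>t \<in> {t\<^sub>0..T}. \<forall>t' \<in> {t\<^sub>0..T}. t \<le> t' \<longrightarrow>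
       (strong_identity D U R (fobj A t) (fobj A t') \<longleftrightarrow>
        (\<exists>f. f \<in> hom (Sys D U R) (fobj A t') (fobj A t)))"
      using strong_diachronic_identity_iff[OF FA] by blast
    show "strong_diachronic_identity_throughout D U R t\<^sub>0 T A \<longleftrightarrow>
       factors_through_inclusion (interval_cat t\<^sub>0 T) (Core (Sys D U R)) A"
      by (rule strong_diachronic_identity_throughout_iff[OF FA])
    show "\<forall>t \<in> {t\<^sub>0..T}.
       (\<exists>h \<in> hom (Sys D U R) (fobj A t) (fobj B t).
          \<exists>p. time_synchronous_rep D U R t\<^sub>0 T Tok prof t h p) \<longrightarrow>
       weak_identity (fobj A t) (fobj B t)"
      using hom_Sys_weak_identity by blast
    show "(\<exists>\<eta>. \<eta> \<in> hom (Traj D U R t\<^sub>0 T Tok prof) A B) \<longrightarrow>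
       (\<forall>t \<in> {t\<^sub>0..T}. weak_identity (fobj A t) (fobj B t))"
      using hom_Sys_weak_identity unfolding hom_Traj_iff sync_arrow_def by blast
    show "\<forall>t \<in> {t\<^sub>0..T}.
       strong_synchronic_identity D U R t\<^sub>0 T Tok prof A B t \<longleftrightarrow>
       (\<exists>h \<in> hom (Sys D U R) (fobj A t) (fobj B t).
          \<exists>k \<in> hom (Sys D U R) (fobj B t) (fobj A t).
            (\<exists>p. time_synchronous_rep D U R t\<^sub>0 T Tok prof t h p) \<and>
            (\<exists>p. time_synchronous_rep D U R t\<^sub>0 T Tok prof t k p))"
      unfolding strong_synchronic_identity_iff sync_arrow_def by blast
    show "isomorphic (Traj D U R t\<^sub>0 T Tok prof) A B \<longleftrightarrow>
       (\<forall>t \<in> {t\<^sub>0..T}. strong_synchronic_identity D U R t\<^sub>0 T Tok prof A B t)"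
      by (rule isomorphic_Traj_iff[OF A B])
  qed
qed

end
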